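(* Let $G$ and $H$ be connected graphs with vertex degrees bounded above by a constant $\delta$. Let $\phi\colon G\to H$ and $\psi\colon H\to G$ be $c$-quasi-isometries, where $c$ is a positive integer, such that $\mathrm{dist}_G(u,\psi\phi u)\le c$ for every vertex $u$ of $G$. Let $\{f_k\}_{k\ge1}$ be a sequence of positive integers. If $G$ has the $\{f_k\}_{k\ge1}$-retaining property, then $H$ has the $\{b_k\}_{k\ge1}$-retaining property, where \[ b_k=\left(f_{2c(k-1)+1}+f_{2c(k-1)+2}+\cdots+f_{2ck}\right)\delta^{c^2+2c+1}.\]
   Context: Graphs carry the path-metric on their vertex sets. A map $\phi\colon X\to Y$ between metric spaces is a $c$-quasi-isometry if $\frac1c d_X(x_1,x_2)-c\le d_Y(\phi x_1,\phi x_2)\le c\,d_X(x_1,x_2)+c$ for all $x_1,x_2$ and every point of $Y$ is within distance $c$ of the image of $\phi$; a $c$-quasi-isometry of graphs is one between their vertex sets. Growth: for non-decreasing $f,g\colon\mathbb N\to\mathbb N$ write $f\preceq g$ if there is an integer $C>0$ with $f(n)\le Cg(Cn+C)+C$ for all $n$, and $f\sim g$ if both $f\preceq g$ and $g\preceq f$. For a discrete proper metric space $Y$ and nonempty finite $A\subseteq Y$, $\beta_{Y,A}(n)=|\{y:\mathrm{dist}(A,y)\le n\}|$ and $\mathsf{Growth}(Y)$ is its $\sim$-class; for a subset $U$ of vertices, $\mathsf{Growth}(U)$ uses the restricted path-metric. Fire game on a connected graph $G$ (reach $1$): an $\{f_k\}$-strategy is a sequence $\{W_k\}_{k\ge1}$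 of vertex sets with $|W_k|\le f_k$; given a finite initial fire $X_0$, for $k>0$ the set $X_k$ consists of vertices connected to a vertex of $X_{k-1}$ by a path of length at most $1$ containing no vertex of $(W_1\cup\cdots\cup W_k)\setminus X_{k-1}$. The strategy is retaining for $X_0$ if $U=V(G)\setminus\bigcup_{k\ge0}X_k$ satisfies $\mathsf{Growth}(U)=\mathsf{Growth}(G)$. $G$ has the $\{f_k\}$-retaining property if every finite set of vertices $X_0$ admits a retaining $\{f_k\}$-strategy. *)

theory Defs
  imports Complex_Main
begin

text \<open>
  A simple undirected graph is given by its (possibly infinite) vertex set and its adjacency
  relation.  Paths are non-empty vertex lists, so a path of length \<open>n\<close> has \<open>n + 1\<close> entries;
  repeated vertices are allowed.
\<close>

definition simple_graph :: "'a set \<Rightarrow> ('a \<Rightarrow> 'a \<Rightarrow> bool) \<Rightarrow> bool" where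
  "simple_graph V E \<longleftrightarrow> (\<forall>u v. E u v \<longrightarrow> u \<in> V \<and> v \<in> V) \<and> symp E \<and> irreflp E"

definition path_from_to ::
    "'a set \<Rightarrow> ('a \<Rightarrow> 'a \<Rightarrow> bool) \<Rightarrow> 'a \<Rightarrow> 'a list \<Rightarrow> 'a \<Rightarrow> bool" where
  "path_from_to V E u p v \<longleftrightarrow>
     p \<noteq> [] \<and> set p \<subseteq> V \<and> successively E p \<and> hd p = u \<and> last p = v"

definition path_length :: "'a list \<Rightarrow> nat" where
  "path_length p = length p - 1"

definition connected_graph :: "'a set \<Rightarrow> ('a \<Rightarrow> 'a \<Rightarrow> bool) \<Rightarrow> bool" where
  "connected_graph V E \<longleftrightarrow>
     simple_graph V E \<and> (\<forall>u\<in>V. \<forall>v\<in>V. \<exists>p. path_from_to V E u p v)"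

definition degrees_bounded :: "'a set \<Rightarrow> ('a \<Rightarrow> 'a \<Rightarrow> bool) \<Rightarrow> nat \<Rightarrow> bool" where
  "degrees_bounded V E \<delta> \<longleftrightarrow> (\<forall>v\<in>V. finite {w. E v w} \<and> card {w. E v w} \<le> \<delta>)"

text \<open>The path-metric; only meaningful when \<open>u\<close> and \<open>v\<close> are joined by a path.\<close>

definition graph_dist :: "'a set \<Rightarrow> ('a \<Rightarrow> 'a \<Rightarrow> bool) \<Rightarrow> 'a \<Rightarrow> 'a \<Rightarrow> real" where
  "graph_dist V E u v = real (LEAST n. \<exists>p. path_from_to V E u p v \<and> path_length p = n)"

definition quasi_isometry ::
    "real \<Rightarrow> 'a set \<Rightarrow> ('a \<Rightarrow> 'a \<Rightarrow> real) \<Rightarrow> 'b set \<Rightarrow> ('b \<Rightarrow> 'b \<Rightarrow> real) \<Rightarrow> ('a \<Rightarrow> 'b) \<Rightarrow> bool" where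
  "quasi_isometry c X dX Y dY \<phi> \<longleftrightarrow>
     \<phi> ` X \<subseteq> Y \<and>
     (\<forall>x1\<in>X. \<forall>x2\<in>X. (1 / c) * dX x1 x2 - c \<le> dY (\<phi> x1) (\<phi> x2) \<and>
                     dY (\<phi> x1) (\<phi> x2) \<le> c * dX x1 x2 + c) \<and>
     (\<forall>y\<in>Y. \<exists>x\<in>X. dY y (\<phi> x) \<le> c)"

definition growth_le :: "(nat \<Rightarrow> nat) \<Rightarrow> (nat \<Rightarrow> nat) \<Rightarrow> bool" where
  "growth_le f g \<longleftrightarrow> (\<exists>C>0. \<forall>n. f n \<le> C * g (C * n + C) + C)"

definition growth_equiv :: "(nat \<Rightarrow> nat) \<Rightarrow> (nat \<Rightarrow> nat) \<Rightarrow> bool" where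
  "growth_equiv f g \<longleftrightarrow> growth_le f g \<and> growth_le g f"

text \<open>
  The function \<open>\<beta>\<close> counting the points of \<open>Y\<close> at distance at most \<open>n\<close> from \<open>A\<close>.  It is used for
  proper discrete spaces only, where the counted set is finite.
\<close>

definition ball_count :: "'a set \<Rightarrow> ('a \<Rightarrow> 'a \<Rightarrow> real) \<Rightarrow> 'a set \<Rightarrow> nat \<Rightarrow> nat" where
  "ball_count Y d A n = card {y \<in> Y. (INF a\<in>A. d a y) \<le> real n}"

text \<open>
  The equivalence class does not depend on the base set \<open>A\<close> when \<open>Y\<close> is proper and discrete.
  The empty space has no base set; its growth is the empty class, so it differs from the growth
  of every non-empty space.
\<close>

definition Growth :: "'a set \<Rightarrow> ('a \<Rightarrow> 'a \<Rightarrow> real) \<Rightarrow> (nat \<Rightarrow> nat) set" where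
  "Growth Y d =
     {f. mono f \<and> (\<exists>A. finite A \<and> A \<noteq> {} \<and> A \<subseteq> Y \<and> growth_equiv f (ball_count Y d A))}"

text \<open>
  Sequences indexed by \<open>k \<ge> 1\<close> are functions on \<open>nat\<close> whose value at \<open>0\<close> is never used.
\<close>

definition strategy :: "'a set \<Rightarrow> (nat \<Rightarrow> nat) \<Rightarrow> (nat \<Rightarrow> 'a set) \<Rightarrow> bool" where
  "strategy V f W \<longleftrightarrow> (\<forall>k\<ge>1. W k \<subseteq> V \<and> finite (W k) \<and> card (W k) \<le> f k)"

primrec fire ::
    "'a set \<Rightarrow> ('a \<Rightarrow> 'a \<Rightarrow> bool) \<Rightarrow> (nat \<Rightarrow> 'a set) \<Rightarrow> 'a set \<Rightarrow> nat \<Rightarrow> 'a set" where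
  "fire V E W X0 0 = X0"
| "fire V E W X0 (Suc k) =
     {v \<in> V. \<exists>u \<in> fire V E W X0 k. \<exists>p. path_from_to V E u p v \<and> path_length p \<le> 1 \<and>
        set p \<inter> ((\<Union>i\<in>{1..Suc k}. W i) - fire V E W X0 k) = {}}"

definition retaining_for ::
    "'a set \<Rightarrow> ('a \<Rightarrow> 'a \<Rightarrow> bool) \<Rightarrow> (nat \<Rightarrow> 'a set) \<Rightarrow> 'a set \<Rightarrow> bool" where
  "retaining_for V E W X0 \<longleftrightarrow>
     Growth (V - (\<Union>k. fire V E W X0 k)) (graph_dist V E) = Growth V (graph_dist V E)"

definition retaining_property ::
    "'a set \<Rightarrow> ('a \<Rightarrow> 'a \<Rightarrow> bool) \<Rightarrow> (nat \<Rightarrow> nat) \<Rightarrow> bool" where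
  "retaining_property V E f \<longleftrightarrow>
     (\<forall>X0. X0 \<subseteq> V \<and> finite X0 \<longrightarrow> (\<exists>W. strategy V f W \<and> retaining_for V E W X0))"

end

theory Submission
  imports Defs
begin

text \<open>
  Given a finite fire \<open>X\<^sub>0\<close> in \<open>H\<close>, take a retaining strategy \<open>W\<close> of \<open>G\<close> for the \<open>2c\<close>-neighbourhood
  of \<open>\<psi> X\<^sub>0\<close>, and at time \<open>k\<close> protect in \<open>H\<close> all \<open>v\<close> such that \<open>\<psi> v\<close> is within \<open>2c - 1\<close> of
  \<open>W\<^sub>j\<close> for some \<open>j\<close> with \<open>2c(k - 1) < j \<le> 2ck\<close>.  Neighbours in \<open>H\<close> have images at distance at most
  \<open>2c\<close>, so \<open>\<psi>\<close> sends the fire of \<open>H\<close> into that of \<open>G\<close>; because of the enlarged initial fire in \<open>G\<close>,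
  it does so with one step of \<open>H\<close> (\<open>2c\<close> steps of \<open>G\<close>) to spare.  This head start shows that \<open>\<phi> u\<close> never
  burns when \<open>u\<close> is saved: otherwise \<open>\<psi> (\<phi> u)\<close>, at distance at most \<open>c\<close> from \<open>u\<close>, burns early, so
  a vertex between them has been protected early enough for \<open>\<phi> u\<close> to be protected in time.
  Thus \<open>\<phi>\<close> embeds the saved part of \<open>G\<close> coarsely into that of \<open>H\<close>, and the growths agree.
\<close>

section \<open>Growth functions\<close>

text \<open>The second bound is inserted into the first; monotonicity of \<open>h\<close> allows its
  argument to be enlarged.\<close>

lemma growth_le_trans:
  assumes "growth_le f g" "growth_le g h" "mono h"
  shows "growth_le f h"
proof -
  obtain C where C: "C > 0" "\<And>n. f n \<le> C * g (C * n + C) + C"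
    using assms(1) unfolding growth_le_def by auto
  obtain D where D: "D > 0" "\<And>n. g n \<le> D * h (D * n + D) + D"
    using assms(2) unfolding growth_le_def by auto
  \<comment> \<open>\<open>K\<close> dominates the slope and the offset of the composed argument as
    well as the outer factor and constant.\<close>
  define K where "K = C * D + C + D"
  have "f n \<le> K * h (K * n + K) + K" for n
  proof -
    have "D * (C * n + C) + D \<le> K * n + K"
      unfolding K_def by (simp add: algebra_simps)
    then have "h (D * (C * n + C) + D) \<le> h (K * n + K)"
      using \<open>mono h\<close> by (rule monoD[rotated])
    then have "g (C * n + C) \<le> D * h (K * n + K) + D"
      using D(2)[of "C * n + C"] by (meson add_le_mono1 le_trans mult_le_mono2)
    then have "C * g (C * n + C) + C \<le> C * (D * h (K * n + K) + D) + C"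
      by (meson add_le_mono1 mult_le_mono2)
    also have "\<dots> \<le> K * h (K * n + K) + K"
      unfolding K_def by (simp add: algebra_simps)
    finally show ?thesis
      using C(2)[of n] by linarith
  qed
  moreover have "K > 0"
    using C(1) D(1) unfolding K_def by simp
  ultimately show ?thesis
    unfolding growth_le_def by blast
qed

lemma growth_equiv_refl: "mono f \<Longrightarrow> growth_equiv f f"
proof -
  assume "mono f"
  then have "f n \<le> 1 * f (1 * n + 1) + 1" for n
    by (auto intro: le_SucI monoD)
  then show ?thesis
    unfolding growth_equiv_def growth_le_def by (meson zero_less_one)
qed

lemma growth_equiv_trans:
  "growth_equiv f g \<Longrightarrow> growth_equiv g h \<Longrightarrow> mono f \<Longrightarrow> mono h \<Longrightarrow> growth_equiv f h"
  unfolding growth_equiv_def using growth_le_trans by blast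

text \<open>The infimum over a finite non-empty set is a minimum, hence attained.\<close>

lemma ball_count_eq:
  assumes "finite A" "A \<noteq> {}"
  shows "ball_count Y d A n = card {y \<in> Y. \<exists>a\<in>A. d a y \<le> real n}"
proof -
  have "(INF a\<in>A. d a y) \<le> real n \<longleftrightarrow> (\<exists>a\<in>A. d a y \<le> real n)" for y
    using assms by (simp add: cInf_eq_Min Min_le_iff)
  then show ?thesis
    unfolding ball_count_def by simp
qed

lemma Growth_empty: "Growth {} d = {}"
  unfolding Growth_def by auto

lemma ball_count_in_Growth:
  "a \<in> Y \<Longrightarrow> mono (ball_count Y d {a}) \<Longrightarrow> ball_count Y d {a} \<in> Growth Y d"
  unfolding Growth_def using growth_equiv_refl by blast

section \<open>Bounded degree graphs\<close>

text \<open>Turns vertex lists into relation powers, which are easy to split and compose.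
  \<open>u \<in> V\<close> excludes the trivial walk at a point outside the graph; edges keep all
  later vertices in \<open>V\<close>.\<close>

lemma path_iff_relpowp:
  assumes "simple_graph V E" "u \<in> V"
  shows "(\<exists>p. path_from_to V E u p v \<and> path_length p = n) \<longleftrightarrow> (E ^^ n) u v"
  using assms(2)
proof (induction n arbitrary: u)
  case 0
  show ?case
  proof
    assume "\<exists>p. path_from_to V E u p v \<and> path_length p = 0"
    then obtain p where "path_from_to V E u p v" "length p - 1 = 0"
      unfolding path_length_def by auto
    then show "(E ^^ 0) u v"
      unfolding path_from_to_def by (cases p) auto
  next
    assume "(E ^^ 0) u v"
    then have "path_from_to V E u [u] v \<and> path_length [u] = 0"
      using 0 unfolding path_from_to_def path_length_def by simp
    then show "\<exists>p. path_from_to V E u p v \<and> path_length p = 0" ..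
  qed
next
  case (Suc n)
  show ?case
  proof
    assume "\<exists>p. path_from_to V E u p v \<and> path_length p = Suc n"
    then obtain p where p: "path_from_to V E u p v" "length p - 1 = Suc n"
      unfolding path_length_def by auto
    then obtain x q where q: "p = u # x # q"
      unfolding path_from_to_def
      by (metis One_nat_def Suc_diff_Suc diff_is_0_eq hd_Cons_tl le_Suc_eq length_0_conv
          length_tl less_one list.sel(1) nat.distinct(1) neq_Nil_conv)
    then have "E u x" "path_from_to V E x (x # q) v" "path_length (x # q) = n" "x \<in> V"
      using p unfolding path_from_to_def path_length_def by auto
    then show "(E ^^ Suc n) u v"
      using Suc.IH[of x] by (metis relpowp_Suc_I2)
  next
    assume "(E ^^ Suc n) u v"
    then obtain x where x: "E u x" "(E ^^ n) x v"
      by (metis relpowp_Suc_D2)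
    then have "x \<in> V"
      using assms(1) unfolding simple_graph_def by auto
    then obtain q where q: "path_from_to V E x q v" "path_length q = n"
      using Suc.IH x(2) by blast
    then have "path_from_to V E u (u # q) v \<and> path_length (u # q) = Suc n"
      using x(1) Suc.prems unfolding path_from_to_def path_length_def
      by (cases q) auto
    then show "\<exists>p. path_from_to V E u p v \<and> path_length p = Suc n" ..
  qed
qed

lemma relpowp_finite_card:
  assumes "degrees_bounded V E \<delta>" "simple_graph V E" "v \<in> V"
  shows "finite {w. (E ^^ n) v w} \<and> card {w. (E ^^ n) v w} \<le> \<delta> ^ n"
proof (induction n)
  case 0
  then show ?case by simp
next
  case (Suc n)
  let ?S = "{w. (E ^^ n) v w}"
  \<comment> \<open>Points outside \<open>V\<close> have no neighbours, so the degree bound holds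
    for every \<open>w\<close>.\<close>
  have deg: "finite {x. E w x}" "card {x. E w x} \<le> \<delta>" for w
  proof -
    have "finite {x. E w x} \<and> card {x. E w x} \<le> \<delta>"
    proof (cases "w \<in> V")
      case True
      then show ?thesis
        using assms(1) unfolding degrees_bounded_def by blast
    next
      case False
      then have "{x. E w x} = {}"
        using assms(2) unfolding simple_graph_def by blast
      then show ?thesis by (simp only: finite.emptyI card.empty) simp
    qed
    then show "finite {x. E w x}" "card {x. E w x} \<le> \<delta>" by auto
  qed
  have eq: "{w. (E ^^ Suc n) v w} = (\<Union>w\<in>?S. {x. E w x})"
    by auto
  have "card (\<Union>w\<in>?S. {x. E w x}) \<le> (\<Sum>w\<in>?S. card {x. E w x})"
    using Suc by (intro card_UN_le) auto
  also have "\<dots> \<le> card ?S * \<delta>"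
    using sum_bounded_above[of ?S "\<lambda>w. card {x. E w x}" \<delta>] deg(2) by simp
  also have "\<dots> \<le> \<delta> ^ Suc n"
    using Suc by (simp add: mult.commute)
  finally show ?case
    unfolding eq using Suc deg(1) by auto
qed

text \<open>If \<delta> \<le> 1, a vertex and its at most one neighbour are closed under adjacency;
  by connectedness they are the whole graph, which is then finite.\<close>

lemma infinite_connected_degree_ge_2:
  assumes "connected_graph V E" "degrees_bounded V E \<delta>" "infinite V"
  shows "2 \<le> \<delta>"
proof (rule ccontr)
  assume "\<not> 2 \<le> \<delta>"
  then have "\<delta> \<le> 1" by simp
  have sg: "simple_graph V E"
    using assms(1) unfolding connected_graph_def by simp
  obtain v where v: "v \<in> V"
    using assms(3) by fastforce
  define S where "S = insert v {w. E v w}"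
  have uniq: "x = y" if "E w x" "E w y" for w x y
  proof -
    have "w \<in> V"
      using sg that unfolding simple_graph_def by auto
    then have "finite {z. E w z}" "card {z. E w z} \<le> 1"
      using assms(2) \<open>\<delta> \<le> 1\<close> unfolding degrees_bounded_def by fastforce+
    then show ?thesis
      using that by (auto simp: card_le_Suc0_iff_eq)
  qed
  have closed: "x \<in> S" if "w \<in> S" "E w x" for w x
    using that uniq sg unfolding S_def simple_graph_def symp_def by blast
  have "w \<in> S" if "(E ^^ n) v w" for n w
    using that
  proof (induction n arbitrary: w)
    case 0
    then show ?case by (simp add: S_def)
  next
    case (Suc n)
    then show ?case using closed by auto
  qed
  moreover have "\<exists>n. (E ^^ n) v w" if "w \<in> V" for w
    using assms(1) v that path_iff_relpowp[OF sg v] unfolding connected_graph_def by metis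
  ultimately have "V \<subseteq> S" by blast
  moreover have "finite S"
    using assms(2) v unfolding S_def degrees_bounded_def by simp
  ultimately show False
    using assms(3) finite_subset by blast
qed

text \<open>Bounds the ball size \<open>1 + \<delta> + ... + \<delta> ^ r\<close> by a single power
  of \<delta>; this is why \<delta> = 1 has to be excluded.\<close>

lemma sum_power_less:
  fixes \<delta> :: nat
  assumes "2 \<le> \<delta>"
  shows "(\<Sum>i\<le>r. \<delta> ^ i) < \<delta> ^ Suc r"
proof (induction r)
  case 0
  then show ?case using assms by simp
next
  case (Suc r)
  have "2 * \<delta> ^ Suc r \<le> \<delta> * \<delta> ^ Suc r"
    using assms by (intro mult_le_mono1)
  then have "\<delta> ^ Suc r + \<delta> ^ Suc r \<le> \<delta> ^ Suc (Suc r)"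
    by (simp only: power_Suc[of _ "Suc r"] mult_2)
  then show ?case
    using Suc unfolding sum.atMost_Suc by linarith
qed

section \<open>The path-metric and the size of balls\<close>

locale bounded_degree_graph =
  fixes V :: "'v set" and E :: "'v \<Rightarrow> 'v \<Rightarrow> bool" and \<delta> :: nat
  assumes connected: "connected_graph V E"
    and degrees: "degrees_bounded V E \<delta>"
    and \<delta>_ge_2: "2 \<le> \<delta>"
begin

abbreviation d :: "'v \<Rightarrow> 'v \<Rightarrow> real" where
  "d \<equiv> graph_dist V E"

lemma simple: "simple_graph V E"
  using connected unfolding connected_graph_def by simp

lemma edge_in: "E u v \<Longrightarrow> u \<in> V \<and> v \<in> V"
  using simple unfolding simple_graph_def by auto

lemma relpowp_sym: "(E ^^ n) u v \<Longrightarrow> (E ^^ n) v u"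
proof (induction n arbitrary: v)
  case 0
  then show ?case by simp
next
  case (Suc n)
  then show ?case
    using simple unfolding simple_graph_def symp_def by (metis relpowp_Suc_E relpowp_Suc_I2)
qed

lemma relpowp_in: "(E ^^ n) u v \<Longrightarrow> u \<in> V \<Longrightarrow> v \<in> V"
  by (cases n) (auto dest: edge_in)

text \<open>By connectedness the least length is attained, so metric bounds become walks.\<close>

lemma dist_le_iff:
  assumes "u \<in> V" "v \<in> V"
  shows "d u v \<le> real r \<longleftrightarrow> (\<exists>n\<le>r. (E ^^ n) u v)"
proof -
  have eq: "d u v = real (LEAST n. (E ^^ n) u v)"
    unfolding graph_dist_def path_iff_relpowp[OF simple assms(1)] ..
  have "\<exists>n. (E ^^ n) u v"
    using connected assms path_iff_relpowp[OF simple assms(1)] unfolding connected_graph_def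
    by metis
  then have "(E ^^ (LEAST n. (E ^^ n) u v)) u v"
    by (rule LeastI_ex)
  then show ?thesis
    unfolding eq by (auto intro: Least_le order_trans)
qed

lemma dist_nat: "\<exists>n. d u v = real n"
  unfolding graph_dist_def by blast

lemma dist_triangle:
  assumes "u \<in> V" "v \<in> V" "w \<in> V"
  shows "d u w \<le> d u v + d v w"
proof -
  obtain a b where ab: "d u v = real a" "d v w = real b"
    using dist_nat by metis
  then obtain a' b' where "a' \<le> a" "b' \<le> b" "(E ^^ a') u v" "(E ^^ b') v w"
    using dist_le_iff assms by (metis order_refl)
  then have "(E ^^ (a' + b')) u w" "a' + b' \<le> a + b"
    by (auto simp: relpowp_add)
  then have "d u w \<le> real (a + b)"
    using dist_le_iff assms by blast
  then show ?thesis using ab by simp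
qed

lemma dist_sym:
  assumes "u \<in> V" "v \<in> V"
  shows "d u v = d v u"
proof -
  have "(E ^^ n) u v \<longleftrightarrow> (E ^^ n) v u" for n
    using relpowp_sym by blast
  then show ?thesis
    unfolding graph_dist_def path_iff_relpowp[OF simple assms(1)]
      path_iff_relpowp[OF simple assms(2)] by simp
qed

lemma ball_finite_card:
  assumes "v \<in> V"
  shows "finite {w \<in> V. d v w \<le> real r}" "card {w \<in> V. d v w \<le> real r} \<le> \<delta> ^ Suc r"
proof -
  have eq: "{w \<in> V. d v w \<le> real r} = (\<Union>n\<le>r. {w. (E ^^ n) v w})"
    using dist_le_iff assms relpowp_in by auto
  note R = relpowp_finite_card[OF degrees simple assms]
  show "finite {w \<in> V. d v w \<le> real r}"
    unfolding eq using R by auto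
  have "card (\<Union>n\<le>r. {w. (E ^^ n) v w}) \<le> (\<Sum>n\<le>r. card {w. (E ^^ n) v w})"
    by (intro card_UN_le) auto
  also have "\<dots> \<le> (\<Sum>n\<le>r. \<delta> ^ n)"
    using R by (intro sum_mono) auto
  also have "\<dots> \<le> \<delta> ^ Suc r"
    using sum_power_less[OF \<delta>_ge_2] by (rule less_imp_le)
  finally show "card {w \<in> V. d v w \<le> real r} \<le> \<delta> ^ Suc r"
    unfolding eq .
qed

lemma neighbourhood_finite:
  assumes "finite A" "A \<subseteq> V" "Y \<subseteq> V"
  shows "finite {y \<in> Y. \<exists>a\<in>A. d a y \<le> real n}"
proof -
  have "{y \<in> Y. \<exists>a\<in>A. d a y \<le> real n} \<subseteq> (\<Union>a\<in>A. {y \<in> V. d a y \<le> real n})"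
    using assms by auto
  then show ?thesis
    using ball_finite_card(1) assms by (meson finite_UN finite_subset subsetD)
qed

lemma ball_count_mono:
  assumes "finite A" "A \<noteq> {}" "A \<subseteq> V" "Y \<subseteq> V"
  shows "mono (ball_count Y d A)"
proof (rule monoI)
  fix m n :: nat
  assume "m \<le> n"
  then show "ball_count Y d A m \<le> ball_count Y d A n"
    unfolding ball_count_eq[OF assms(1,2)]
    by (intro card_mono neighbourhood_finite assms) (force intro: order_trans)
qed

text \<open>A non-empty fibre lies in the ball of radius \<open>r\<close> about any of its
  points.\<close>

lemma fibre_finite_card:
  assumes "\<And>x1 x2. x1 \<in> Y \<Longrightarrow> x2 \<in> Y \<Longrightarrow> h x1 = h x2 \<Longrightarrow> d x1 x2 \<le> real r" "Y \<subseteq> V"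
  shows "finite {x \<in> Y. h x = y}" "card {x \<in> Y. h x = y} \<le> \<delta> ^ Suc r"
proof -
  have "finite {x \<in> Y. h x = y} \<and> card {x \<in> Y. h x = y} \<le> \<delta> ^ Suc r"
  proof (cases "\<exists>x\<in>Y. h x = y")
    case True
    then obtain x where "x \<in> Y" "h x = y" by blast
    then have "{x \<in> Y. h x = y} \<subseteq> {w \<in> V. d x w \<le> real r}" "x \<in> V"
      using assms by auto
    then show ?thesis
      using ball_finite_card[of x r] by (meson card_mono finite_subset order_trans)
  next
    case False
    then have "{x \<in> Y. h x = y} = {}" by blast
    then show ?thesis by (simp only: finite.emptyI card.empty) simp
  qed
  then show "finite {x \<in> Y. h x = y}" "card {x \<in> Y. h x = y} \<le> \<delta> ^ Suc r" by auto
qed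

end

section \<open>Fire\<close>

context bounded_degree_graph
begin

lemma fire_subset: "X0 \<subseteq> V \<Longrightarrow> fire V E W X0 k \<subseteq> V"
  by (cases k) auto

text \<open>A path of length at most 1 is a single vertex or an edge. Its starting vertex burns
  already and cannot block it, so only the end point matters.\<close>

lemma fire_Suc:
  assumes "X0 \<subseteq> V"
  shows "fire V E W X0 (Suc k) =
    fire V E W X0 k \<union> {v. (\<exists>u\<in>fire V E W X0 k. E u v) \<and> v \<notin> (\<Union>i\<in>{1..Suc k}. W i)}"
    (is "_ = ?F \<union> ?N")
proof (intro equalityI subsetI)
  fix v
  assume "v \<in> fire V E W X0 (Suc k)"
  then obtain u p where u: "u \<in> ?F" "path_from_to V E u p v" "path_length p \<le> 1"
    "set p \<inter> ((\<Union>i\<in>{1..Suc k}. W i) - ?F) = {}"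
    by auto
  have "u \<in> V"
    using fire_subset[OF assms] u(1) by blast
  have "u = v \<or> E u v"
  proof (cases "path_length p")
    case 0
    then show ?thesis
      using path_iff_relpowp[OF simple \<open>u \<in> V\<close>, of v 0] u(2) by auto
  next
    case (Suc n)
    then show ?thesis
      using path_iff_relpowp[OF simple \<open>u \<in> V\<close>, of v 1] u(2,3) by auto
  qed
  moreover have "v \<in> set p"
    using u(2) unfolding path_from_to_def by auto
  ultimately show "v \<in> ?F \<union> ?N"
    using u by blast
next
  fix v
  assume "v \<in> ?F \<union> ?N"
  then consider "v \<in> ?F" | u where "u \<in> ?F" "E u v" "v \<notin> (\<Union>i\<in>{1..Suc k}. W i)"
    by blast
  then show "v \<in> fire V E W X0 (Suc k)"
  proof cases
    case 1
    then have "v \<in> V"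
      using fire_subset[OF assms] by blast
    then have "path_from_to V E v [v] v" "path_length [v] \<le> 1"
      "set [v] \<inter> ((\<Union>i\<in>{1..Suc k}. W i) - ?F) = {}"
      using 1 unfolding path_from_to_def path_length_def by auto
    then show ?thesis
      using 1 \<open>v \<in> V\<close> unfolding fire.simps by blast
  next
    case 2
    then have "path_from_to V E u [u, v] v" "path_length [u, v] \<le> 1"
      "set [u, v] \<inter> ((\<Union>i\<in>{1..Suc k}. W i) - ?F) = {}"
      using edge_in unfolding path_from_to_def path_length_def by auto
    then show ?thesis
      using 2 edge_in unfolding fire.simps by blast
  qed
qed

lemma fire_mono:
  assumes "X0 \<subseteq> V" "m \<le> n"
  shows "fire V E W X0 m \<subseteq> fire V E W X0 n"
  using assms(2) by (rule lift_Suc_mono_le[rotated]) (auto simp only: fire_Suc[OF assms(1)])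

text \<open>
  The bound \<open>i < n\<close> is strict because a burning vertex cannot be protected; this saves one in the
  radius \<open>2c - 1\<close> below and gives exactly the exponent \<open>c\<^sup>2 + 2c + 1\<close>.
\<close>

lemma fire_along_walk:
  assumes "X0 \<subseteq> V" "u \<in> fire V E W X0 k" "(E ^^ n) u v"
  shows "v \<in> fire V E W X0 (k + n) \<or>
    (\<exists>j\<in>{1..k + n}. \<exists>w\<in>W j. \<exists>i<n. (E ^^ (n - i)) u w \<and> (E ^^ i) w v)"
  using assms(2,3)
proof (induction n arbitrary: k u)
  case 0
  then show ?case by simp
next
  case (Suc n)
  then obtain x where x: "E u x" "(E ^^ n) x v"
    by (metis relpowp_Suc_D2)
  show ?case
  proof (cases "x \<in> (\<Union>i\<in>{1..Suc k}. W i)")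
    case True
    then obtain j where "j \<in> {1..Suc k}" "x \<in> W j"
      by blast
    \<comment> \<open>The walk is stopped at its first step: \<open>w = x\<close>, with all
      \<open>n\<close> remaining steps still ahead, so \<open>i = n\<close>.\<close>
    then have "j \<in> {1..k + Suc n} \<and> x \<in> W j \<and> n < Suc n \<and> (E ^^ (Suc n - n)) u x \<and> (E ^^ n) x v"
      using x by auto
    then show ?thesis by blast
  next
    case False
    then have "x \<in> fire V E W X0 (Suc k)"
      using Suc.prems x(1) unfolding fire_Suc[OF assms(1)] by blast
    from Suc.IH[OF this x(2)] show ?thesis
    proof (elim disjE bexE exE conjE)
      fix j w i
      assume *: "j \<in> {1..Suc k + n}" "w \<in> W j" "i < n" "(E ^^ (n - i)) x w" "(E ^^ i) w v"
      then have "(E ^^ (Suc n - i)) u w"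
        using relpowp_Suc_I2[OF x(1) *(4)] by (simp add: Suc_diff_le)
      then have "j \<in> {1..k + Suc n} \<and> w \<in> W j \<and> i < Suc n \<and> (E ^^ (Suc n - i)) u w \<and> (E ^^ i) w v"
        using * by auto
      then show ?thesis by blast
    qed simp
  qed
qed

text \<open>Metric form of the walk version, applied to a walk of length \<open>m \<le> n\<close>;
  the strict bound \<open>i < m\<close> yields the radius \<open>n - 1\<close>.\<close>

corollary fire_within_distance:
  assumes "X0 \<subseteq> V" "u \<in> fire V E W X0 k" "v \<in> V" "d u v \<le> real n" "\<And>j. j \<ge> 1 \<Longrightarrow> W j \<subseteq> V"
  shows "v \<in> fire V E W X0 (k + n) \<or>
    (\<exists>j\<in>{1..k + n}. \<exists>w\<in>W j. d u w \<le> real n \<and> d w v \<le> real (n - 1))"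
proof -
  have "u \<in> V"
    using assms(1,2) fire_subset by blast
  then obtain m where m: "m \<le> n" "(E ^^ m) u v"
    using assms dist_le_iff by blast
  from fire_along_walk[OF assms(1,2) m(2)] show ?thesis
  proof (elim disjE bexE exE conjE)
    assume "v \<in> fire V E W X0 (k + m)"
    then show ?thesis
      using fire_mono[OF assms(1), of "k + m" "k + n"] m(1) by auto
  next
    fix j w i
    assume *: "j \<in> {1..k + m}" "w \<in> W j" "i < m" "(E ^^ (m - i)) u w" "(E ^^ i) w v"
    then have "w \<in> V"
      using assms(5)[of j] by auto
    moreover have "i \<le> n - 1" "m - i \<le> n"
      using * m(1) by auto
    ultimately have "d w v \<le> real (n - 1)" "d u w \<le> real n"
      using *(4,5) assms(3) \<open>u \<in> V\<close> dist_le_iff by blast+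
    then show ?thesis
      using * m(1) by fastforce
  qed
qed

end

section \<open>Coarse maps\<close>

text \<open>\<open>h\<close> sends the points of \<open>Y\<close> within \<open>n\<close> of
  \<open>A\<close> to points within \<open>c * n + c + M\<close> of \<open>A'\<close>, and each
  image point accounts for at most \<open>D\<close> points.\<close>

lemma growth_le_coarse_map:
  fixes h :: "'a \<Rightarrow> 'b" and c D :: nat
  assumes "bounded_degree_graph V E \<delta>" "bounded_degree_graph V' E' \<delta>'"
    and "Y \<subseteq> V" "Y' \<subseteq> V'" "h ` Y \<subseteq> Y'"
    and lip: "\<And>x y. x \<in> Y \<Longrightarrow> y \<in> Y \<Longrightarrow>
      graph_dist V' E' (h x) (h y) \<le> real c * graph_dist V E x y + real c"
    and fib: "\<And>y. finite {x \<in> Y. h x = y} \<and> card {x \<in> Y. h x = y} \<le> D"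
    and A: "finite A" "A \<noteq> {}" "A \<subseteq> Y"
    and A': "finite A'" "A' \<noteq> {}" "A' \<subseteq> Y'"
  shows "growth_le (ball_count Y (graph_dist V E) A) (ball_count Y' (graph_dist V' E') A')"
proof -
  interpret G: bounded_degree_graph V E \<delta> by fact
  interpret H: bounded_degree_graph V' E' \<delta>' by fact
  obtain a' where a': "a' \<in> A'"
    using A' by blast
  \<comment> \<open>\<open>M\<close> bounds the distances from a fixed \<open>a'\<close> to the
    images of the finitely many points of \<open>A\<close>.\<close>
  obtain M :: nat where M: "\<And>a. a \<in> A \<Longrightarrow> H.d a' (h a) \<le> real M"
  proof -
    obtain M :: nat where "Max ((\<lambda>a. H.d a' (h a)) ` A) \<le> real M"
      using real_arch_simple by blast
    then show ?thesis
      using that[of M] A by (auto simp: Max_le_iff)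
  qed
  \<comment> \<open>\<open>K\<close> exceeds the factor \<open>D\<close>, the slope \<open>c\<close>
    and the offset \<open>c + M\<close>; the summand 1 makes it positive.\<close>
  define K where "K = D + c + M + 1"
  have mono: "mono (ball_count Y' H.d A')"
    using A' \<open>Y' \<subseteq> V'\<close> by (intro H.ball_count_mono) auto
  have "ball_count Y G.d A n \<le> K * ball_count Y' H.d A' (K * n + K) + K" for n
  proof -
    define T where "T = {y \<in> Y'. \<exists>a\<in>A'. H.d a y \<le> real (c * n + c + M)}"
    have "finite T"
      unfolding T_def using A' \<open>Y' \<subseteq> V'\<close> by (intro H.neighbourhood_finite) auto
    have "{y \<in> Y. \<exists>a\<in>A. G.d a y \<le> real n} \<subseteq> (\<Union>z\<in>T. {x \<in> Y. h x = z})"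
    proof
      fix y
      assume "y \<in> {y \<in> Y. \<exists>a\<in>A. G.d a y \<le> real n}"
      then obtain a where a: "y \<in> Y" "a \<in> A" "G.d a y \<le> real n" by blast
      have "H.d a' (h y) \<le> H.d a' (h a) + H.d (h a) (h y)"
        using a a' A A' assms(4,5) by (intro H.dist_triangle) blast+
      also have "\<dots> \<le> real M + (real c * G.d a y + real c)"
        using M[OF a(2)] lip[of a y] a A by (intro add_mono) auto
      also have "\<dots> \<le> real M + (real c * real n + real c)"
        using a(3) by (simp add: mult_left_mono)
      finally have "h y \<in> T"
        unfolding T_def using a a' assms(5) by (auto intro!: bexI[of _ a'])
      then show "y \<in> (\<Union>z\<in>T. {x \<in> Y. h x = z})"
        using a(1) by blast
    qed
    then have "ball_count Y G.d A n \<le> card (\<Union>z\<in>T. {x \<in> Y. h x = z})"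
      unfolding ball_count_eq[OF A(1,2)] using \<open>finite T\<close> fib
      by (intro card_mono) auto
    also have "\<dots> \<le> (\<Sum>z\<in>T. card {x \<in> Y. h x = z})"
      using \<open>finite T\<close> by (rule card_UN_le)
    also have "\<dots> \<le> card T * D"
      using sum_bounded_above[of T "\<lambda>z. card {x \<in> Y. h x = z}" D] fib by simp
    also have "card T = ball_count Y' H.d A' (c * n + c + M)"
      unfolding T_def ball_count_eq[OF A'(1,2)] ..
    also have "\<dots> * D \<le> ball_count Y' H.d A' (K * n + K) * K"
      using mono by (intro mult_le_mono monoD[OF mono]) (auto simp: K_def algebra_simps)
    finally show ?thesis
      by (simp add: mult.commute)
  qed
  moreover have "K > 0" unfolding K_def by simp
  ultimately show ?thesis
    unfolding growth_le_def by blast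
qed

text \<open>The lower quasi-isometry bound puts points with the same image within
  \<open>c\<^sup>2\<close> of each other. This is the source of \<open>c\<^sup>2 + 1\<close> in the
  final exponent.\<close>

lemma quasi_isometry_fibre:
  fixes h :: "'a \<Rightarrow> 'b" and c :: nat
  assumes "bounded_degree_graph V E \<delta>" "bounded_degree_graph V' E' \<delta>'" "c > 0"
    and qi: "quasi_isometry (real c) V (graph_dist V E) V' (graph_dist V' E') h"
    and "Y \<subseteq> V"
  shows "finite {x \<in> Y. h x = y} \<and> card {x \<in> Y. h x = y} \<le> \<delta> ^ Suc (c\<^sup>2)"
proof -
  interpret G: bounded_degree_graph V E \<delta> by fact
  interpret H: bounded_degree_graph V' E' \<delta>' by fact
  have "G.d x1 x2 \<le> real (c\<^sup>2)" if "x1 \<in> Y" "x2 \<in> Y" "h x1 = h x2" for x1 x2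
  proof -
    have V: "x1 \<in> V" "x2 \<in> V" "h x1 \<in> V'"
      using that \<open>Y \<subseteq> V\<close> qi unfolding quasi_isometry_def by auto
    have "H.d (h x1) (h x2) \<le> real 0"
      using V that(3) H.dist_le_iff[of "h x1" "h x2" 0] by simp
    moreover have "(1 / real c) * G.d x1 x2 - real c \<le> H.d (h x1) (h x2)"
      using V qi unfolding quasi_isometry_def by blast
    ultimately have "G.d x1 x2 / real c \<le> real c"
      by simp
    then show ?thesis
      using \<open>c > 0\<close> by (simp add: divide_le_eq power2_eq_square)
  qed
  then show ?thesis
    using G.fibre_finite_card[of Y h "c\<^sup>2" y] \<open>Y \<subseteq> V\<close> by blast
qed

corollary growth_le_quasi_isometry:
  fixes h :: "'a \<Rightarrow> 'b" and c :: nat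
  assumes "bounded_degree_graph V E \<delta>" "bounded_degree_graph V' E' \<delta>'" "c > 0"
    and qi: "quasi_isometry (real c) V (graph_dist V E) V' (graph_dist V' E') h"
    and "Y \<subseteq> V" "Y' \<subseteq> V'" "h ` Y \<subseteq> Y'"
    and A: "finite A" "A \<noteq> {}" "A \<subseteq> Y"
    and A': "finite A'" "A' \<noteq> {}" "A' \<subseteq> Y'"
  shows "growth_le (ball_count Y (graph_dist V E) A) (ball_count Y' (graph_dist V' E') A')"
proof (rule growth_le_coarse_map[OF assms(1,2,5,6,7) _ _ A A'])
  show "graph_dist V' E' (h x) (h y) \<le> real c * graph_dist V E x y + real c"
    if "x \<in> Y" "y \<in> Y" for x y
    using that qi \<open>Y \<subseteq> V\<close> unfolding quasi_isometry_def by blast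
qed (rule quasi_isometry_fibre[OF assms(1,2,3) qi \<open>Y \<subseteq> V\<close>])

text \<open>The identity is a coarse map with \<open>c = D = 1\<close>. For \<open>Y = Y'\<close>
  this shows that the base set does not affect the growth class.\<close>

corollary growth_le_inclusion:
  assumes "bounded_degree_graph V E \<delta>"
    and "Y \<subseteq> Y'" "Y' \<subseteq> V"
    and "finite A" "A \<noteq> {}" "A \<subseteq> Y"
    and "finite A'" "A' \<noteq> {}" "A' \<subseteq> Y'"
  shows "growth_le (ball_count Y (graph_dist V E) A) (ball_count Y' (graph_dist V E) A')"
proof (rule growth_le_coarse_map[where h = id and c = 1 and D = 1,
      OF assms(1,1) _ _ _ _ _ assms(4-9)])
  show "finite {x \<in> Y. id x = y} \<and> card {x \<in> Y. id x = y} \<le> 1" for y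
  proof -
    have sub: "{x \<in> Y. id x = y} \<subseteq> {y}" by auto
    show ?thesis
      using card_mono[OF _ sub] finite_subset[OF sub] by simp
  qed
qed (use assms in auto)

text \<open>Inclusion gives one direction; the reverse comparison for one pair of base sets carries
  over to all pairs by changing base sets.\<close>

lemma Growth_subset_eqI:
  assumes "bounded_degree_graph V E \<delta>"
    and "U \<subseteq> V" and B: "finite B" "B \<noteq> {}" "B \<subseteq> U"
    and C: "finite C" "C \<noteq> {}" "C \<subseteq> V"
    and le: "growth_le (ball_count V (graph_dist V E) C) (ball_count U (graph_dist V E) B)"
  shows "Growth U (graph_dist V E) = Growth V (graph_dist V E)"
proof -
  interpret G: bounded_degree_graph V E \<delta> by fact
  have mono: "mono (ball_count Y G.d A)" if "Y \<subseteq> V" "finite A" "A \<noteq> {}" "A \<subseteq> Y" for A Y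
    using that by (intro G.ball_count_mono) auto
  note incl = growth_le_inclusion[OF assms(1)]
  have eq: "growth_equiv (ball_count U G.d A) (ball_count V G.d A')"
    if "finite A" "A \<noteq> {}" "A \<subseteq> U" "finite A'" "A' \<noteq> {}" "A' \<subseteq> V" for A A'
    unfolding growth_equiv_def
  proof
    show "growth_le (ball_count U G.d A) (ball_count V G.d A')"
      using that \<open>U \<subseteq> V\<close> by (intro incl) auto
    \<comment> \<open>The chain runs from \<open>V\<close>, \<open>A'\<close> over \<open>V\<close>,
      \<open>C\<close> and \<open>U\<close>, \<open>B\<close> to \<open>U\<close>,
      \<open>A\<close>.\<close>
    have "growth_le (ball_count V G.d A') (ball_count V G.d C)"
      using that C by (intro incl) auto
    then have "growth_le (ball_count V G.d A') (ball_count U G.d B)"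
      using le mono[OF \<open>U \<subseteq> V\<close> B] by (rule growth_le_trans)
    moreover have "growth_le (ball_count U G.d B) (ball_count U G.d A)"
      using that B \<open>U \<subseteq> V\<close> by (intro incl) auto
    ultimately show "growth_le (ball_count V G.d A') (ball_count U G.d A)"
      using mono[OF \<open>U \<subseteq> V\<close> that(1-3)] by (rule growth_le_trans)
  qed
  show ?thesis
  proof (intro equalityI subsetI)
    fix f
    assume "f \<in> Growth U G.d"
    then obtain A where A: "mono f" "finite A" "A \<noteq> {}" "A \<subseteq> U"
      "growth_equiv f (ball_count U G.d A)"
      unfolding Growth_def by blast
    then have AV: "A \<subseteq> V"
      using \<open>U \<subseteq> V\<close> by blast
    have "growth_equiv f (ball_count V G.d A)"
      using A(5) eq[OF A(2-4) A(2,3) AV] A(1) mono[OF order_refl A(2,3) AV]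
      by (rule growth_equiv_trans)
    then show "f \<in> Growth V G.d"
      unfolding Growth_def using A(1-3) AV by blast
  next
    fix f
    assume "f \<in> Growth V G.d"
    then obtain A where A: "mono f" "finite A" "A \<noteq> {}" "A \<subseteq> V"
      "growth_equiv f (ball_count V G.d A)"
      unfolding Growth_def by blast
    \<comment> \<open>\<open>A\<close> need not lie in \<open>U\<close>, so it is exchanged for
      \<open>B\<close>.\<close>
    have "growth_equiv (ball_count V G.d A) (ball_count U G.d B)"
      using eq[OF B A(2-4)] unfolding growth_equiv_def by blast
    with A(5) have "growth_equiv f (ball_count U G.d B)"
      using A(1) mono[OF \<open>U \<subseteq> V\<close> B] by (rule growth_equiv_trans)
    then show "f \<in> Growth U G.d"
      unfolding Growth_def using A(1) B by blast
  qed
qed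

section \<open>Transfer of strategies\<close>

text \<open>One turn in \<open>H\<close> stands for a block of \<open>2 * c\<close> turns in
  \<open>G\<close>. For \<open>c > 0\<close> the blocks with \<open>k \<ge> 1\<close> partition the
  positive integers.\<close>

definition transferred_strategy ::
    "'a set \<Rightarrow> ('a \<Rightarrow> 'a \<Rightarrow> bool) \<Rightarrow> 'b set \<Rightarrow> ('b \<Rightarrow> 'a) \<Rightarrow> nat \<Rightarrow> (nat \<Rightarrow> 'a set) \<Rightarrow>
     nat \<Rightarrow> 'b set" where
  "transferred_strategy VG EG VH \<psi> c W k =
    {v \<in> VH. \<exists>j\<in>{2 * c * (k - 1) + 1..2 * c * k}. \<exists>w\<in>W j.
       graph_dist VG EG w (\<psi> v) \<le> real (2 * c - 1)}"

locale fire_transfer =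
  G: bounded_degree_graph VG EG \<delta> + H: bounded_degree_graph VH EH \<delta>
  for VG :: "'a set" and EG and VH :: "'b set" and EH and \<delta> +
  fixes \<phi> :: "'a \<Rightarrow> 'b" and \<psi> :: "'b \<Rightarrow> 'a" and c :: nat
    and f :: "nat \<Rightarrow> nat" and W :: "nat \<Rightarrow> 'a set" and X0 :: "'b set"
  assumes c_pos: "c > 0"
    and qi_\<phi>: "quasi_isometry (real c) VG (graph_dist VG EG) VH (graph_dist VH EH) \<phi>"
    and qi_\<psi>: "quasi_isometry (real c) VH (graph_dist VH EH) VG (graph_dist VG EG) \<psi>"
    and close: "\<And>u. u \<in> VG \<Longrightarrow> graph_dist VG EG u (\<psi> (\<phi> u)) \<le> real c"
    and W: "strategy VG f W"
    and X0: "X0 \<subseteq> VH"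
begin

abbreviation "B \<equiv> transferred_strategy VG EG VH \<psi> c W"
text \<open>\<psi> moves neighbours at most \<open>2 * c\<close> apart, so \<open>Y0\<close> already
  contains the image of the fire of \<open>H\<close> after one turn.\<close>

definition "Y0 = {y \<in> VG. \<exists>x\<in>\<psi> ` X0. G.d x y \<le> real (2 * c)}"
abbreviation "X \<equiv> fire VH EH B X0"
abbreviation "Y \<equiv> fire VG EG W Y0"

lemma Y0: "Y0 \<subseteq> VG"
  unfolding Y0_def by auto

lemma \<psi>_in: "v \<in> VH \<Longrightarrow> \<psi> v \<in> VG"
  using qi_\<psi> unfolding quasi_isometry_def by auto

lemma \<phi>_in: "u \<in> VG \<Longrightarrow> \<phi> u \<in> VH"
  using qi_\<phi> unfolding quasi_isometry_def by auto

lemma W_in: "j \<ge> 1 \<Longrightarrow> W j \<subseteq> VG"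
  using W unfolding strategy_def by blast

text \<open>\<open>B k\<close> is a union over the turns \<open>j\<close> of the block, the
  \<open>w \<in> W j\<close>, the points near \<open>w\<close> and the fibres of \<psi> over them.
  There are at most \<open>\<delta> ^ (2 * c)\<close> points near each \<open>w\<close> and
  \<open>\<delta> ^ (c\<^sup>2 + 1)\<close> points in each fibre.\<close>

lemma strategy_B:
  "strategy VH (\<lambda>k. (\<Sum>j = 2 * c * (k - 1) + 1..2 * c * k. f j) * \<delta> ^ (c\<^sup>2 + 2 * c + 1)) B"
  unfolding strategy_def
proof (intro allI impI)
  fix k :: nat
  assume "1 \<le> k"
  define J where "J = {2 * c * (k - 1) + 1..2 * c * k}"
  define N where "N w = {x \<in> VG. G.d w x \<le> real (2 * c - 1)}" for w
  define F where "F x = {v \<in> VH. \<psi> v = x}" for x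
  have F: "finite (F x)" "card (F x) \<le> \<delta> ^ Suc (c\<^sup>2)" for x
    unfolding F_def
    using quasi_isometry_fibre[OF H.bounded_degree_graph_axioms G.bounded_degree_graph_axioms
        c_pos qi_\<psi> order_refl] by auto
  have WJ: "finite (W j)" "card (W j) \<le> f j" "W j \<subseteq> VG" if "j \<in> J" for j
    using that W unfolding strategy_def J_def by auto
  \<comment> \<open>As \<open>c > 0\<close>, the radius \<open>2 * c - 1\<close> gives the exponent
    \<open>2 * c\<close>.\<close>
  have N: "finite (N w)" "card (N w) \<le> \<delta> ^ (2 * c)" if "w \<in> VG" for w
    using that G.ball_finite_card[of w "2 * c - 1"] c_pos unfolding N_def by auto
  have fW: "finite (\<Union>x\<in>N w. F x) \<and> card (\<Union>x\<in>N w. F x) \<le> \<delta> ^ (c\<^sup>2 + 2 * c + 1)"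
    if "w \<in> VG" for w
  proof -
    have "card (\<Union>x\<in>N w. F x) \<le> (\<Sum>x\<in>N w. card (F x))"
      using N that by (intro card_UN_le) auto
    also have "\<dots> \<le> card (N w) * \<delta> ^ Suc (c\<^sup>2)"
      using sum_bounded_above[of "N w" "\<lambda>x. card (F x)" "\<delta> ^ Suc (c\<^sup>2)"] F(2) by simp
    also have "\<dots> \<le> \<delta> ^ (2 * c) * \<delta> ^ Suc (c\<^sup>2)"
      using N that by (intro mult_le_mono1) auto
    also have "\<dots> = \<delta> ^ (c\<^sup>2 + 2 * c + 1)"
      by (simp add: power_add mult_ac)
    finally show ?thesis
      using N F that by auto
  qed
  have eq: "B k = (\<Union>j\<in>J. \<Union>w\<in>W j. \<Union>x\<in>N w. F x)"
    unfolding transferred_strategy_def J_def N_def F_def using \<psi>_in by auto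
  have "card (B k) \<le> (\<Sum>j\<in>J. card (\<Union>w\<in>W j. \<Union>x\<in>N w. F x))"
    unfolding eq by (intro card_UN_le) (simp add: J_def)
  also have "\<dots> \<le> (\<Sum>j\<in>J. f j * \<delta> ^ (c\<^sup>2 + 2 * c + 1))"
  proof (rule sum_mono)
    fix j
    assume j: "j \<in> J"
    have "card (\<Union>w\<in>W j. \<Union>x\<in>N w. F x) \<le> (\<Sum>w\<in>W j. card (\<Union>x\<in>N w. F x))"
      using WJ[OF j] by (intro card_UN_le) auto
    also have "\<dots> \<le> (\<Sum>w\<in>W j. \<delta> ^ (c\<^sup>2 + 2 * c + 1))"
      using fW WJ[OF j] by (intro sum_mono) auto
    also have "\<dots> \<le> f j * \<delta> ^ (c\<^sup>2 + 2 * c + 1)"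
      using WJ[OF j] by simp
    finally show "card (\<Union>w\<in>W j. \<Union>x\<in>N w. F x) \<le> f j * \<delta> ^ (c\<^sup>2 + 2 * c + 1)" .
  qed
  finally have "card (B k) \<le> (\<Sum>j\<in>J. f j) * \<delta> ^ (c\<^sup>2 + 2 * c + 1)"
    by (simp only: sum_distrib_right)
  moreover have "finite (B k)"
  proof -
    have "finite (\<Union>w\<in>W j. \<Union>x\<in>N w. F x)" if "j \<in> J" for j
      using WJ[OF that] fW by blast
    then show ?thesis
      unfolding eq J_def by blast
  qed
  moreover have "B k \<subseteq> VH"
    unfolding transferred_strategy_def by auto
  ultimately show "B k \<subseteq> VH \<and> finite (B k) \<and>
      card (B k) \<le> (\<Sum>j = 2 * c * (k - 1) + 1..2 * c * k. f j) * \<delta> ^ (c\<^sup>2 + 2 * c + 1)"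
    unfolding J_def by simp
qed

text \<open>\<open>j\<close> lies in block \<open>(j - 1) div (2 * c) + 1\<close>, which is at most
  \<open>k\<close>; the shift by 1 is due to blocks starting just after a multiple of
  \<open>2 * c\<close>.\<close>

lemma protected_in_time:
  assumes "j \<in> {1..2 * c * k}" "w \<in> W j" "v \<in> VH" "G.d w (\<psi> v) \<le> real (2 * c - 1)"
  shows "v \<in> (\<Union>i\<in>{1..k}. B i)"
proof -
  define i where "i = (j - 1) div (2 * c) + 1"
  have "(j - 1) div (2 * c) < k"
    using assms(1) c_pos by (intro less_mult_imp_div_less) (auto simp: mult_ac)
  then have "i \<in> {1..k}"
    unfolding i_def by auto
  moreover have "j \<in> {2 * c * (i - 1) + 1..2 * c * i}"
  proof -
    have "2 * c * ((j - 1) div (2 * c)) \<le> j - 1"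
      by (rule times_div_less_eq_dividend)
    moreover have "j - 1 < 2 * c * ((j - 1) div (2 * c)) + 2 * c"
      using c_pos dividend_less_times_div[of "2 * c" "j - 1"] by simp
    moreover have "2 * c * i = 2 * c * ((j - 1) div (2 * c)) + 2 * c"
      "2 * c * (i - 1) = 2 * c * ((j - 1) div (2 * c))"
      unfolding i_def by simp_all
    moreover have "1 \<le> j"
      using assms(1) by simp
    ultimately show ?thesis
      unfolding atLeastAtMost_iff by linarith
  qed
  ultimately show ?thesis
    unfolding transferred_strategy_def using assms(2-4) by blast
qed

section \<open>Comparison of the two fires\<close>

lemma \<psi>_edge:
  assumes "EH u v"
  shows "G.d (\<psi> u) (\<psi> v) \<le> real (2 * c)"
proof -
  have V: "u \<in> VH" "v \<in> VH"
    using H.edge_in assms by auto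
  have "(EH ^^ 1) u v" using assms by (simp only: relpowp_1)
  then have "H.d u v \<le> real 1"
    using V H.dist_le_iff by blast
  moreover have "G.d (\<psi> u) (\<psi> v) \<le> real c * H.d u v + real c"
    using qi_\<psi> V unfolding quasi_isometry_def by blast
  moreover have "real c * H.d u v \<le> real c * 1"
    using \<open>H.d u v \<le> real 1\<close> by (intro mult_left_mono) auto
  ultimately show ?thesis by simp
qed

lemma \<psi>_X0: "v \<in> X0 \<Longrightarrow> \<psi> v \<in> Y0"
proof -
  assume v: "v \<in> X0"
  then have "\<psi> v \<in> VG"
    using X0 \<psi>_in by blast
  moreover from this have "G.d (\<psi> v) (\<psi> v) \<le> real (2 * c)"
    using G.dist_le_iff[of "\<psi> v" "\<psi> v" "2 * c"] relpowp_0_I[of EG "\<psi> v"] by blast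
  ultimately show ?thesis
    unfolding Y0_def using v by blast
qed

text \<open>Induction with \<open>2 * c\<close> turns of \<open>G\<close> per turn of
  \<open>H\<close>; \<open>Suc k\<close> against \<open>2 * c * k\<close> records the lead of one
  turn.\<close>

lemma \<psi>_fire: "v \<in> X (Suc k) \<Longrightarrow> \<psi> v \<in> Y (2 * c * k)"
proof (induction k arbitrary: v)
  case 0
  \<comment> \<open>Protection is ignored in the first turn: the radius of \<open>Y0\<close> covers
    the images of all neighbours of \<open>X0\<close>.\<close>
  then consider "v \<in> X0" | u where "u \<in> X0" "EH u v"
    unfolding H.fire_Suc[OF X0] by auto
  then show ?case
  proof cases
    case 1
    then show ?thesis using \<psi>_X0 by simp
  next
    case 2
    then show ?thesis
      using \<psi>_edge[of u v] \<psi>_in H.edge_in[of u v] unfolding Y0_def by auto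
  qed
next
  case (Suc k)
  have mono: "Y (2 * c * k) \<subseteq> Y (2 * c * Suc k)"
    by (intro G.fire_mono Y0) simp
  show ?case
  proof (cases "v \<in> X (Suc k)")
    case True
    then show ?thesis
      using Suc.IH mono by blast
  next
    case False
    with Suc.prems obtain u where u: "u \<in> X (Suc k)" "EH u v"
      and v: "v \<notin> (\<Union>i\<in>{1..Suc (Suc k)}. B i)"
      using H.fire_Suc[OF X0, of B "Suc k"] by blast
    have "v \<in> VH"
      using u(2) H.edge_in by blast
    have "2 * c * k + 2 * c = 2 * c * Suc k" by simp
    with G.fire_within_distance[OF Y0 Suc.IH[OF u(1)] \<psi>_in[OF \<open>v \<in> VH\<close>] \<psi>_edge[OF u(2)] W_in]
    consider "\<psi> v \<in> Y (2 * c * Suc k)"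
      | j w where "j \<in> {1..2 * c * Suc k}" "w \<in> W j" "G.d w (\<psi> v) \<le> real (2 * c - 1)"
      by metis
    then show ?thesis
    proof cases
      \<comment> \<open>The obstruction \<open>w\<close> would have \<open>v\<close> protected by
        turn \<open>Suc k\<close>, yet \<open>v\<close> catches fire unprotected in turn
        \<open>Suc (Suc k)\<close>.\<close>
      case 2
      then have "v \<in> (\<Union>i\<in>{1..Suc k}. B i)"
        using protected_in_time \<open>v \<in> VH\<close> by blast
      then show ?thesis
        using v by fastforce
    qed
  qed
qed

text \<open>If \<open>\<phi> u\<close> caught fire in turn \<open>Suc k\<close>, then
  \<open>\<psi> (\<phi> u)\<close> would burn by turn \<open>2 * c * k\<close>. Since
  \<open>u\<close> never burns, some \<open>w\<close> within \<open>c\<close> is protected by turn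
  \<open>2 * c * k + c\<close>. As \<open>c \<le> 2 * c - 1\<close> and
  \<open>2 * c * k + c \<le> 2 * c * Suc k\<close>, this protects \<open>\<phi> u\<close> in
  time.\<close>

lemma \<phi>_saved:
  assumes u: "u \<in> VG - (\<Union>k. Y k)"
  shows "\<phi> u \<in> VH - (\<Union>k. X k)"
proof -
  have V: "u \<in> VG" "\<phi> u \<in> VH" "\<psi> (\<phi> u) \<in> VG"
    using u \<phi>_in \<psi>_in by auto
  have near: "G.d (\<psi> (\<phi> u)) u \<le> real c"
    using close[OF V(1)] G.dist_sym V by simp
  \<comment> \<open>Induction singles out the first turn in which \<open>\<phi> u\<close> burns;
    unless this is turn 0, the vertex is unprotected then.\<close>
  have "\<phi> u \<notin> X k" for k
  proof (induction k)
    case 0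
    have "u \<notin> Y 0" using u by blast
    then show ?case
      using near V(1) unfolding Y0_def by auto
  next
    case (Suc k)
    show ?case
    proof
      assume burnt: "\<phi> u \<in> X (Suc k)"
      then have unprot: "\<phi> u \<notin> (\<Union>i\<in>{1..Suc k}. B i)"
        using Suc H.fire_Suc[OF X0, of B k] by blast
      have "u \<notin> Y (2 * c * k + c)"
        using u by blast
      then obtain j w where *: "j \<in> {1..2 * c * k + c}" "w \<in> W j" "G.d (\<psi> (\<phi> u)) w \<le> real c"
        using G.fire_within_distance[OF Y0 \<psi>_fire[OF burnt] V(1) near W_in] by blast
      have "w \<in> VG"
        using *(1,2) W_in[of j] by auto
      then have "G.d w (\<psi> (\<phi> u)) \<le> real (2 * c - 1)"
        using *(3) G.dist_sym V(3) c_pos by fastforce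
      moreover have "j \<in> {1..2 * c * Suc k}"
        using *(1) by auto
      ultimately show False
        using protected_in_time *(2) V(2) unprot by blast
    qed
  qed
  then show ?thesis
    using V by blast
qed

text \<open>Growth is compared along a chain: \<open>H\<close> to \<open>G\<close> by \<psi>,
  \<open>G\<close> to its saved part by retention, and on to the saved part of \<open>H\<close> by
  \<phi>.\<close>

lemma retaining:
  assumes ne: "VG \<noteq> {}" and ret: "retaining_for VG EG W Y0"
  shows "retaining_for VH EH B X0"
proof -
  let ?U = "VG - (\<Union>k. Y k)" and ?U' = "VH - (\<Union>k. X k)"
  obtain a where a: "a \<in> VG" using ne by blast
  obtain b where b: "b \<in> VH" using \<phi>_in a by blast
  \<comment> \<open>A member of the class of \<open>VG\<close> also belongs to that of
    \<open>?U\<close>; this provides a non-empty base set in \<open>?U\<close> together with the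
    inequality.\<close>
  have "ball_count VG G.d {a} \<in> Growth VG G.d"
    using a by (intro ball_count_in_Growth G.ball_count_mono) auto
  then have "ball_count VG G.d {a} \<in> Growth ?U G.d"
    using ret unfolding retaining_for_def by simp
  then obtain A where A: "finite A" "A \<noteq> {}" "A \<subseteq> ?U"
    "growth_le (ball_count VG G.d {a}) (ball_count ?U G.d A)"
    unfolding Growth_def growth_equiv_def by blast
  have \<phi>A: "finite (\<phi> ` A)" "\<phi> ` A \<noteq> {}" "\<phi> ` A \<subseteq> ?U'"
    using A \<phi>_saved by blast+
  note axs = G.bounded_degree_graph_axioms H.bounded_degree_graph_axioms
  have "growth_le (ball_count VH H.d {b}) (ball_count VG G.d {a})"
    using a b \<psi>_in by (intro growth_le_quasi_isometry[OF axs(2,1) c_pos qi_\<psi>]) auto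
  then have "growth_le (ball_count VH H.d {b}) (ball_count ?U G.d A)"
    using A(4) by (rule growth_le_trans) (rule G.ball_count_mono; use A(1-3) in blast)
  moreover have "growth_le (ball_count ?U G.d A) (ball_count ?U' H.d (\<phi> ` A))"
    using A(1-3) \<phi>A
  proof (intro growth_le_quasi_isometry[OF axs c_pos qi_\<phi>])
    show "\<phi> ` ?U \<subseteq> ?U'"
      using \<phi>_saved by (rule image_subsetI)
  qed auto
  moreover have "mono (ball_count ?U' H.d (\<phi> ` A))"
    using \<phi>A by (intro H.ball_count_mono) blast+
  ultimately have "growth_le (ball_count VH H.d {b}) (ball_count ?U' H.d (\<phi> ` A))"
    by (rule growth_le_trans)
  then show ?thesis
    unfolding retaining_for_def using b \<phi>A
    by (intro Growth_subset_eqI[OF axs(2), where B = "\<phi> ` A" and C = "{b}"]) auto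
qed

end

section \<open>Reduction to an infinite graph and conclusion\<close>

theorem theorem4p1:
  fixes VG :: "'a set" and EG :: "'a \<Rightarrow> 'a \<Rightarrow> bool"
    and VH :: "'b set" and EH :: "'b \<Rightarrow> 'b \<Rightarrow> bool"
    and \<phi> :: "'a \<Rightarrow> 'b" and \<psi> :: "'b \<Rightarrow> 'a"
    and c \<delta> :: nat and f :: "nat \<Rightarrow> nat"
  assumes "connected_graph VG EG" and "connected_graph VH EH"
    and "degrees_bounded VG EG \<delta>" and "degrees_bounded VH EH \<delta>"
    and "c > 0"
    and "quasi_isometry (real c) VG (graph_dist VG EG) VH (graph_dist VH EH) \<phi>"
    and "quasi_isometry (real c) VH (graph_dist VH EH) VG (graph_dist VG EG) \<psi>"
    and "\<forall>u\<in>VG. graph_dist VG EG u (\<psi> (\<phi> u)) \<le> real c"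
    and "\<forall>k\<ge>1. f k > 0"
    and "retaining_property VG EG f"
  shows "retaining_property VH EH
           (\<lambda>k. (\<Sum>j = 2 * c * (k - 1) + 1..2 * c * k. f j) * \<delta> ^ (c\<^sup>2 + 2 * c + 1))"
proof (cases "VG = {}")
  case True
  \<comment> \<open>Every point of \<open>VH\<close> is near the image of \<phi>, so
    \<open>H\<close> is empty too and the empty strategy retains it.\<close>
  then have "VH = {}"
    using assms(6) unfolding quasi_isometry_def by blast
  then show ?thesis
    unfolding retaining_property_def strategy_def retaining_for_def
    by (auto intro!: exI[of _ "\<lambda>_. {}"])
next
  case False
  \<comment> \<open>Were \<open>VG\<close> finite, it could be the initial fire. Nothing would be
    saved, so its growth class would be empty, although \<open>VG\<close> is not.\<close>
  have "infinite VG"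
  proof
    assume "finite VG"
    then obtain W where "retaining_for VG EG W VG"
      using assms(10) unfolding retaining_property_def by blast
    moreover have "VG - (\<Union>k. fire VG EG W VG k) = {}"
      using UN_upper[of 0 UNIV "fire VG EG W VG"] by auto
    ultimately have "Growth VG (graph_dist VG EG) = {}"
      unfolding retaining_for_def by (simp only: Growth_empty)
    moreover obtain a where "a \<in> VG" using False by blast
    moreover have "mono (ball_count VG (graph_dist VG EG) {a})"
      unfolding mono_def ball_count_def using \<open>finite VG\<close> by (auto intro: card_mono)
    ultimately show False
      using ball_count_in_Growth[of a VG "graph_dist VG EG"] by simp
  qed
  then have "2 \<le> \<delta>"
    using infinite_connected_degree_ge_2 assms(1,3) by blast
  then interpret G: bounded_degree_graph VG EG \<delta> + H: bounded_degree_graph VH EH \<delta>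
    using assms by unfold_locales
  show ?thesis
    unfolding retaining_property_def
  proof (intro allI impI)
    fix X0
    assume X0: "X0 \<subseteq> VH \<and> finite X0"
    have \<psi>X0: "\<psi> ` X0 \<subseteq> VG" "finite (\<psi> ` X0)"
      using X0 assms(7) unfolding quasi_isometry_def by auto
    \<comment> \<open>This is \<open>Y0\<close>, spelled out because the locale needs
      \<open>W\<close>, which is chosen only for this initial fire.\<close>
    define F0 where "F0 = {y \<in> VG. \<exists>x\<in>\<psi> ` X0. G.d x y \<le> real (2 * c)}"
    have "F0 \<subseteq> VG \<and> finite F0"
      unfolding F0_def using G.neighbourhood_finite[OF \<psi>X0(2,1) order_refl] by blast
    then obtain W where W: "strategy VG f W" "retaining_for VG EG W F0"
      using assms(10) unfolding retaining_property_def by blast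
    interpret T: fire_transfer VG EG VH EH \<delta> \<phi> \<psi> c f W X0
      using assms X0 W(1) by unfold_locales auto
    show "\<exists>W. strategy VH
        (\<lambda>k. (\<Sum>j = 2 * c * (k - 1) + 1..2 * c * k. f j) * \<delta> ^ (c\<^sup>2 + 2 * c + 1)) W \<and>
        retaining_for VH EH W X0"
      using T.strategy_B T.retaining[OF False] W(2) unfolding T.Y0_def F0_def by blast
  qed
qed

end
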